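(* Let $f^0(x,y)$ be a curvature surface on $D=\{(x,y)\in\mathbb{R}^2:x>0\}$ and $F^0=[\phi,X^0_\alpha,X^0_\beta,\xi]$ the frame field determining $f^0$. Then: (1) Along any $x$-curve $x\mapsto f^0(x,y)$ ($y$ fixed), the vector $(yX^0_\beta-\phi)(x,y)$ is constant; that is, an analytic unit vector $\boldsymbol{u}(y)$ of $y$ is determined by $\boldsymbol{u}(y)=(1+y^2)^{-1/2}(yX^0_\beta-\phi)(x,y)$. (2) Let $\boldsymbol{f}(x,y)$ be the analytic unit vector $$\boldsymbol{f}(x,y):=\big((1+y^2)(5+4y^2)\big)^{-1/2}\big(X^0_\beta-2(1+y^2)\xi+y\phi\big)(x,y).$$ Then the surface, regarded as a one-parameter family of $x$-curves, is expressed as $$f^0(x,y)=\frac{1}{2\sqrt5}\sqrt{\frac{5+4y^2}{1+y^2}}\;\boldsymbol{f}(x,y)+A(y),$$ where $A(y)$ is an $\mathbb{R}^4$-valued analytic function of $y$ determined uniquely up to a parallel translation. (3) Any $x$-curve $x\mapsto f^0(x,y)$ lies on a $2$-sphere $\mathbb{S}^2_y$ of radius $\frac{1}{2\sqrt5}\sqrt{\frac{5+4y^2}{1+y^2}}$ in an affine hyperplane $\mathbb{R}^3_y$ perpendicular to $\boldsymbol{u}(y)$, and $A(y)$ is the center of $\mathbb{S}^2_y$.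
   Context: $X_0(x)=\frac52+\sum_{k\ge1}a_kx^{2k}$ (analytic on $\mathbb{R}$), $a_1=1$, $2(k+1)(4k^2+\frac54)a_{k+1}+(2k-1)a_k=0$ $(k\ge1)$. $h(x,y)=2X_0-xX_0'+y^2\frac{X_0'}{x}+\sqrt5$ (positive). On $D$ put $a_1=\frac{2y}{xh}(X_0+\frac{\sqrt5}{2})$, $b_1=-\frac{1}{xh}(X_0+\frac{\sqrt5}{2}+\sqrt5(x^2-y^2))$, $c_1=-\frac{2}{xh}(X_0+\frac{\sqrt5}{2})$, $a_2=-\frac1h(2X_0+\sqrt5-(x^2+y^2)\frac{X_0'}{x})$, $b_2=-\frac{2y}{h}(\frac{X_0'}{2x}+\sqrt5)$, $c_2=\frac{2y}{h}(X_0''-\frac{X_0'}{x})$. The frame field is an analytic orthonormal frame field $F^0=[\phi,X^0_\alpha,X^0_\beta,\xi]$ of $\mathbb{R}^4$ on $D$ satisfying $\phi_x=-a_1X^0_\alpha$, $\xi_x=b_1X^0_\alpha$, $(X^0_\beta)_x=c_1X^0_\alpha$, $(X^0_\alpha)_x=a_1\phi-b_1\xi-c_1X^0_\beta$, $\phi_y=-a_2X^0_\beta$, $\xi_y=b_2X^0_\beta$, $(X^0_\alpha)_y=c_2X^0_\beta$, $(X^0_\beta)_y=a_2\phi-b_2\xi-c_2X^0_\alpha$ (it exists and is unique up to left multiplication by a constant orthogonal matrix). The curvature surface $f^0:D\to\mathbb{R}^4$ determined by $F^0$ is the analytic map, unique up to translation, with $df^0=\frac{x^2-y^2}{xh}X^0_\alpha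 dx+\frac{2y}{h}X^0_\beta dy$. *)

theory Defs
  imports "HOL-Analysis.Analysis"
begin

text \<open>Real analyticity in one and in two real variables: around every point of the set the map is
  the sum of a convergent power series (unconditionally summed, in the two-variable case).
  It is used for open sets only.\<close>

definition real_analytic_on :: "(real \<Rightarrow> 'a::real_normed_vector) \<Rightarrow> real set \<Rightarrow> bool" where
  "real_analytic_on f S \<longleftrightarrow>
     (\<forall>a\<in>S. \<exists>r>0. \<exists>c :: nat \<Rightarrow> 'a. \<forall>t. \<bar>t - a\<bar> < r \<longrightarrow>
        (\<lambda>n. (t - a) ^ n *\<^sub>R c n) sums f t)"

definition real_analytic2_on ::
    "(real \<Rightarrow> real \<Rightarrow> 'a::real_normed_vector) \<Rightarrow> (real \<times> real) set \<Rightarrow> bool" where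
  "real_analytic2_on f S \<longleftrightarrow>
     (\<forall>(a, b)\<in>S. \<exists>r>0. \<exists>c :: nat \<Rightarrow> nat \<Rightarrow> 'a. \<forall>x y. \<bar>x - a\<bar> < r \<and> \<bar>y - b\<bar> < r \<longrightarrow>
        ((\<lambda>(i, j). ((x - a) ^ i * (y - b) ^ j) *\<^sub>R c i j) has_sum f x y) UNIV)"

definition domD :: "(real \<times> real) set" where
  "domD = {(x, y). x > 0}"

text \<open>\<open>X0_coeff k\<close> is the coefficient of \<open>x^(2k)\<close>; the last equation is the recursion
  solved for the higher coefficient, see \<open>X0_coeff_rec\<close>.\<close>

fun X0_coeff :: "nat \<Rightarrow> real" where
  "X0_coeff 0 = 5 / 2"
| "X0_coeff (Suc 0) = 1"
| "X0_coeff (Suc (Suc k)) =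
     - (2 * real (Suc k) - 1) / (2 * (real (Suc k) + 1) * (4 * (real (Suc k))\<^sup>2 + 5 / 4))
       * X0_coeff (Suc k)"

lemma X0_coeff_rec:
  assumes "k \<ge> 1"
  shows "2 * (real k + 1) * (4 * (real k)\<^sup>2 + 5 / 4) * X0_coeff (k + 1)
           + (2 * real k - 1) * X0_coeff k = 0"
proof -
  obtain m where k: "k = Suc m" using assms by (cases k) auto
  have "4 * (real k)\<^sup>2 + 5 / 4 > 0" by (smt (verit) zero_le_power2 divide_pos_pos)
  moreover have "real k + 1 > 0" by simp
  ultimately have nz: "2 * (real k + 1) * (4 * (real k)\<^sup>2 + 5 / 4) \<noteq> 0" by simp
  have *: "X0_coeff (k + 1) =
      - (2 * real k - 1) / (2 * (real k + 1) * (4 * (real k)\<^sup>2 + 5 / 4)) * X0_coeff k"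
    unfolding k by simp
  have "D \<noteq> 0 \<Longrightarrow> D * (- e / D * c) + e * c = 0" for D e c :: real by simp
  from this[OF nz] show ?thesis unfolding * .
qed

definition X0 :: "real \<Rightarrow> real" where
  "X0 x = (\<Sum>k. X0_coeff k * x ^ (2 * k))"

lemma X0_summable: "summable (\<lambda>k. X0_coeff k * x ^ (2 * k))"
proof -
  obtain N :: nat where N: "real N > 2 * x\<^sup>2" using reals_Archimedean2 by blast
  show ?thesis
  proof (rule summable_ratio_test[of "1/2" "Suc N"])
    fix n assume n: "Suc N \<le> n"
    then obtain m where m: "n = Suc m" by (cases n) auto
    let ?d = "2 * (real n + 1) * (4 * (real n)\<^sup>2 + 5 / 4)"
    have n1: "real n \<ge> 1" using n by simp
    have sq: "(real n)\<^sup>2 \<ge> real n" using n1 by (simp add: power2_eq_square)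
    have d1: "?d \<ge> 2 * (real n + 1) * real n"
    proof (intro mult_left_mono)
      show "real n \<le> 4 * (real n)\<^sup>2 + 5 / 4" using sq n1 by linarith
    qed simp
    moreover have "2 * (real n + 1) * real n > 0" using n1 by simp
    ultimately have dpos: "?d > 0" by linarith
    have xn: "2 * x\<^sup>2 \<le> real n" using N n by simp
    have "2 * x\<^sup>2 * (2 * real n - 1) \<le> real n * (2 * (real n + 1))"
      by (intro mult_mono) (use xn n1 in auto)
    hence key: "(2 * real n - 1) / ?d * x\<^sup>2 \<le> 1 / 2"
      using d1 dpos by (simp add: field_simps del: of_nat_Suc)
    have c: "X0_coeff (Suc n) = - (2 * real n - 1) / ?d * X0_coeff n"
      unfolding m by simp
    have "norm (X0_coeff (Suc n) * x ^ (2 * Suc n))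
        = ((2 * real n - 1) / ?d * x\<^sup>2) * norm (X0_coeff n * x ^ (2 * n))"
      unfolding c using n1 dpos by (simp add: abs_mult power_add abs_divide power2_eq_square)
    also have "\<dots> \<le> 1 / 2 * norm (X0_coeff n * x ^ (2 * n))"
      by (intro mult_right_mono key) auto
    finally show "norm (X0_coeff (Suc n) * x ^ (2 * Suc n))
        \<le> 1 / 2 * norm (X0_coeff n * x ^ (2 * n))" .
  qed simp
qed

definition X0' :: "real \<Rightarrow> real" where "X0' = deriv X0"
definition X0'' :: "real \<Rightarrow> real" where "X0'' = deriv X0'"

text \<open>\<open>h\<close> is positive on \<open>domD\<close>, so the divisions by \<open>h\<close> below are genuine.\<close>

definition h :: "real \<Rightarrow> real \<Rightarrow> real" where
  "h x y = 2 * X0 x - x * X0' x + y\<^sup>2 * (X0' x / x) + sqrt 5"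

definition a1 :: "real \<Rightarrow> real \<Rightarrow> real" where
  "a1 x y = 2 * y / (x * h x y) * (X0 x + sqrt 5 / 2)"

definition b1 :: "real \<Rightarrow> real \<Rightarrow> real" where
  "b1 x y = - (1 / (x * h x y)) * (X0 x + sqrt 5 / 2 + sqrt 5 * (x\<^sup>2 - y\<^sup>2))"

definition c1 :: "real \<Rightarrow> real \<Rightarrow> real" where
  "c1 x y = - (2 / (x * h x y)) * (X0 x + sqrt 5 / 2)"

definition a2 :: "real \<Rightarrow> real \<Rightarrow> real" where
  "a2 x y = - (1 / h x y) * (2 * X0 x + sqrt 5 - (x\<^sup>2 + y\<^sup>2) * (X0' x / x))"

definition b2 :: "real \<Rightarrow> real \<Rightarrow> real" where
  "b2 x y = - (2 * y / h x y) * (X0' x / (2 * x) + sqrt 5)"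

definition c2 :: "real \<Rightarrow> real \<Rightarrow> real" where
  "c2 x y = 2 * y / h x y * (X0'' x - X0' x / x)"

text \<open>The four vectors of a frame field are kept as separate curried maps \<open>\<phi>\<close>, \<open>X\<alpha>\<close>, \<open>X\<beta>\<close>, \<open>\<xi>\<close>;
  their values outside \<open>domD\<close> are irrelevant.\<close>

definition orthonormal_frame :: "real ^ 4 \<Rightarrow> real ^ 4 \<Rightarrow> real ^ 4 \<Rightarrow> real ^ 4 \<Rightarrow> bool" where
  "orthonormal_frame p q r s \<longleftrightarrow>
     norm p = 1 \<and> norm q = 1 \<and> norm r = 1 \<and> norm s = 1 \<and>
     p \<bullet> q = 0 \<and> p \<bullet> r = 0 \<and> p \<bullet> s = 0 \<and> q \<bullet> r = 0 \<and> q \<bullet> s = 0 \<and> r \<bullet> s = 0"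

definition frame_field ::
    "(real \<Rightarrow> real \<Rightarrow> real ^ 4) \<Rightarrow> (real \<Rightarrow> real \<Rightarrow> real ^ 4) \<Rightarrow>
     (real \<Rightarrow> real \<Rightarrow> real ^ 4) \<Rightarrow> (real \<Rightarrow> real \<Rightarrow> real ^ 4) \<Rightarrow> bool" where
  "frame_field \<phi> X\<alpha> X\<beta> \<xi> \<longleftrightarrow>
     real_analytic2_on \<phi> domD \<and> real_analytic2_on X\<alpha> domD \<and>
     real_analytic2_on X\<beta> domD \<and> real_analytic2_on \<xi> domD \<and>
     (\<forall>(x, y)\<in>domD.
        orthonormal_frame (\<phi> x y) (X\<alpha> x y) (X\<beta> x y) (\<xi> x y) \<and>
        ((\<lambda>s. \<phi> s y) has_vector_derivative - a1 x y *\<^sub>R X\<alpha> x y) (at x) \<and>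
        ((\<lambda>s. \<xi> s y) has_vector_derivative b1 x y *\<^sub>R X\<alpha> x y) (at x) \<and>
        ((\<lambda>s. X\<beta> s y) has_vector_derivative c1 x y *\<^sub>R X\<alpha> x y) (at x) \<and>
        ((\<lambda>s. X\<alpha> s y) has_vector_derivative
            a1 x y *\<^sub>R \<phi> x y - b1 x y *\<^sub>R \<xi> x y - c1 x y *\<^sub>R X\<beta> x y) (at x) \<and>
        ((\<lambda>t. \<phi> x t) has_vector_derivative - a2 x y *\<^sub>R X\<beta> x y) (at y) \<and>
        ((\<lambda>t. \<xi> x t) has_vector_derivative b2 x y *\<^sub>R X\<beta> x y) (at y) \<and>
        ((\<lambda>t. X\<alpha> x t) has_vector_derivative c2 x y *\<^sub>R X\<beta> x y) (at y) \<and>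
        ((\<lambda>t. X\<beta> x t) has_vector_derivative
            a2 x y *\<^sub>R \<phi> x y - b2 x y *\<^sub>R \<xi> x y - c2 x y *\<^sub>R X\<alpha> x y) (at y))"

text \<open>\<open>curvature_surface X\<alpha> X\<beta> f\<close>: the map \<open>f\<close> is analytic on \<open>domD\<close> with
  \<open>df = (x^2 - y^2)/(x h) X\<alpha> dx + (2 y/h) X\<beta> dy\<close>; only these two frame vectors enter.\<close>

definition curvature_surface ::
    "(real \<Rightarrow> real \<Rightarrow> real ^ 4) \<Rightarrow> (real \<Rightarrow> real \<Rightarrow> real ^ 4) \<Rightarrow>
     (real \<Rightarrow> real \<Rightarrow> real ^ 4) \<Rightarrow> bool" where
  "curvature_surface X\<alpha> X\<beta> f \<longleftrightarrow>
     real_analytic2_on f domD \<and>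
     (\<forall>(x, y)\<in>domD.
        ((\<lambda>(s, t). f s t) has_derivative
          (\<lambda>(dx, dy). dx *\<^sub>R (((x\<^sup>2 - y\<^sup>2) / (x * h x y)) *\<^sub>R X\<alpha> x y)
                    + dy *\<^sub>R ((2 * y / h x y) *\<^sub>R X\<beta> x y))) (at (x, y)))"

definition sphere_direction ::
    "(real \<Rightarrow> real \<Rightarrow> real ^ 4) \<Rightarrow> (real \<Rightarrow> real \<Rightarrow> real ^ 4) \<Rightarrow>
     (real \<Rightarrow> real \<Rightarrow> real ^ 4) \<Rightarrow> real \<Rightarrow> real \<Rightarrow> real ^ 4" where
  "sphere_direction \<phi> X\<beta> \<xi> x y =
     ((1 + y\<^sup>2) * (5 + 4 * y\<^sup>2)) powr (- 1 / 2) *\<^sub>R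
       (X\<beta> x y - (2 * (1 + y\<^sup>2)) *\<^sub>R \<xi> x y + y *\<^sub>R \<phi> x y)"

definition sphere_radius :: "real \<Rightarrow> real" where
  "sphere_radius y = 1 / (2 * sqrt 5) * sqrt ((5 + 4 * y\<^sup>2) / (1 + y\<^sup>2))"

end

theory Submission
  imports Defs "HOL-Complex_Analysis.Cauchy_Integral_Formula"
begin

text \<open>Along an \<open>x\<close>-curve every frame vector other than \<open>X\<alpha>\<close> moves in the direction \<open>X\<alpha>\<close>, so
  differentiating \<open>y X\<beta> - \<phi>\<close>, and \<open>f0\<close> minus the candidate radius vector, in \<open>x\<close> only requires
  comparing scalar coefficients, and these cancel identically.
  Analyticity in \<open>y\<close> is inherited from the slice \<open>x = 1\<close>.\<close>

section \<open>Real analytic maps\<close>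

text \<open>In finite dimension unconditional convergence is absolute: each coordinate is a real
  family, where the two notions agree, and the norm is at most the sum of the absolute coordinates.
  This recovers from the \<open>has_sum\<close> in \<open>real_analytic2_on\<close> the absolute
  convergence needed for multiplying series.\<close>

lemma abs_summable_on_euclidean:
  fixes f :: "'i \<Rightarrow> 'a::euclidean_space"
  assumes "f summable_on A"
  shows "(\<lambda>i. norm (f i)) summable_on A"
proof -
  have "(\<lambda>i. \<bar>f i \<bullet> b\<bar>) summable_on A" for b
    using summable_on_bounded_linear[OF bounded_linear_inner_left[of b] assms]
      summable_on_iff_abs_summable_on_real[of "\<lambda>i. f i \<bullet> b" A] by simp
  then have "(\<lambda>i. \<Sum>b\<in>Basis. \<bar>f i \<bullet> b\<bar>) summable_on A"
    by (induction rule: finite_induct[OF finite_Basis]) (auto intro: summable_on_add)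
  then show ?thesis
    by (rule summable_on_comparison_test) (auto intro: norm_le_l1)
qed

text \<open>Absolute convergence of both factors makes the family over \<open>A \<times> B\<close>
  absolutely summable, so its sum may be computed iteratively, first over \<open>B\<close> and then
  over \<open>A\<close>.\<close>

lemma has_sum_scaleR_product:
  fixes f :: "'i \<Rightarrow> real" and g :: "'j \<Rightarrow> 'a::banach"
  assumes f: "(\<lambda>i. norm (f i)) summable_on A" "(f has_sum s) A"
    and g: "(\<lambda>j. norm (g j)) summable_on B" "(g has_sum t) B"
  shows "((\<lambda>(i, j). f i *\<^sub>R g j) has_sum (s *\<^sub>R t)) (A \<times> B)"
proof (rule has_sum_SigmaI)
  show "((\<lambda>j. case (i, j) of (i, j) \<Rightarrow> f i *\<^sub>R g j) has_sum (f i *\<^sub>R t)) B" for i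
    using has_sum_scaleR[OF g(2)] by simp
  show "((\<lambda>i. f i *\<^sub>R t) has_sum (s *\<^sub>R t)) A"
    by (rule has_sum_bounded_linear[OF bounded_linear_scaleR_left f(2)])
  have "(\<lambda>p. norm (case p of (i, j) \<Rightarrow> f i *\<^sub>R g j)) summable_on A \<times> B"
    unfolding Infinite_Sum.abs_summable_on_Sigma_iff
    using f(1) g(1)
    by (auto simp: infsum_cmult_right' abs_mult
        intro!: summable_on_cmult_right summable_on_cmult_left)
  then show "(\<lambda>(i, j). f i *\<^sub>R g j) summable_on A \<times> B"
    by (rule abs_summable_summable)
qed

text \<open>A Cauchy product in the second variable alone: \<open>g\<close> does not depend on
  \<open>x\<close>, so the power of \<open>x - a\<close> is left untouched.\<close>

lemma real_analytic2_on_scaleR: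
  fixes F :: "real \<Rightarrow> real \<Rightarrow> 'a::euclidean_space"
  assumes g: "real_analytic_on g UNIV" and F: "real_analytic2_on F S"
  shows "real_analytic2_on (\<lambda>x y. g y *\<^sub>R F x y) S"
  unfolding real_analytic2_on_def
proof safe
  fix a b assume ab: "(a, b) \<in> S"
  obtain r1 d where r1: "r1 > 0" and
    d: "\<And>t. \<bar>t - b\<bar> < r1 \<Longrightarrow> (\<lambda>n. (t - b) ^ n * d n) sums g t"
    using g unfolding real_analytic_on_def real_scaleR_def by blast
  obtain r2 c where r2: "r2 > 0" and
    c: "\<And>x y. \<bar>x - a\<bar> < r2 \<Longrightarrow> \<bar>y - b\<bar> < r2 \<Longrightarrow>
        ((\<lambda>(i, j). ((x - a) ^ i * (y - b) ^ j) *\<^sub>R c i j) has_sum F x y) UNIV"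
    using F ab unfolding real_analytic2_on_def by blast
  \<comment> \<open>For each fixed \<open>i\<close>, the convolution of \<open>d\<close> with the
    row \<open>c i\<close>.\<close>
  define e where "e i n = (\<Sum>k\<le>n. d k *\<^sub>R c i (n - k))" for i n
  have "((\<lambda>(i, n). ((x - a) ^ i * (y - b) ^ n) *\<^sub>R e i n) has_sum g y *\<^sub>R F x y) UNIV"
    if x: "\<bar>x - a\<bar> < min r1 r2" and y: "\<bar>y - b\<bar> < min r1 r2" for x y
  proof -
    \<comment> \<open>The series of \<open>g\<close> converges at \<open>t\<close>, which is still
      within \<open>r1\<close> of \<open>b\<close> but farther from \<open>b\<close> than
      \<open>y\<close>; hence it converges absolutely at \<open>y\<close>.\<close>
    define t where "t = b + (\<bar>y - b\<bar> + r1) / 2"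
    have t: "\<bar>t - b\<bar> < r1" "norm (y - b) < norm (t - b)"
      using y r1 by (auto simp: t_def)
    let ?p = "\<lambda>k. (y - b) ^ k * d k"
    let ?q = "\<lambda>(i, j). ((x - a) ^ i * (y - b) ^ j) *\<^sub>R c i j"
    have p: "summable (\<lambda>k. norm (?p k))"
      using powser_insidea[OF _ t(2), of d] d[OF t(1)]
      by (auto simp: mult.commute sums_iff)
    have q: "(?q has_sum F x y) UNIV"
      using c x y by simp
    have "((\<lambda>(k, m). ?p k *\<^sub>R ?q m) has_sum g y *\<^sub>R F x y) (UNIV \<times> UNIV)"
    proof (rule has_sum_scaleR_product)
      show "(\<lambda>k. norm (?p k)) summable_on UNIV"
        using p by (simp add: summable_on_UNIV_nonneg_real_iff)
      show "(?p has_sum g y) UNIV"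
        using p d y by (intro norm_summable_imp_has_sum) auto
      show "(\<lambda>m. norm (?q m)) summable_on UNIV"
        using q by (intro abs_summable_on_euclidean) (auto simp: summable_on_def)
    qed (fact q)
    \<comment> \<open>Terms are regrouped by the total exponent \<open>n = k + j\<close> of
      \<open>y - b\<close>. The fibre over \<open>(i, n)\<close> is the finite set of all
      \<open>k \<le> n\<close>, and its sum is the term with coefficient
      \<open>e i n\<close>.\<close>
    also have "((\<lambda>(k, m). ?p k *\<^sub>R ?q m) has_sum g y *\<^sub>R F x y) (UNIV \<times> UNIV) \<longleftrightarrow>
      ((\<lambda>((i, n), k). ((x - a) ^ i * (y - b) ^ n) *\<^sub>R (d k *\<^sub>R c i (n - k))) has_sum g y *\<^sub>R F x y)
        (SIGMA (i, n):UNIV. {..n})"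
      by (rule has_sum_reindex_bij_witness
          [where j = "\<lambda>(k, i, j). ((i, k + j), k)" and i = "\<lambda>((i, n), k). (k, i, n - k)"])
         (auto simp: power_add mult_ac)
    finally show ?thesis
      by (rule has_sum_SigmaD)
         (auto simp: e_def scaleR_sum_right intro!: has_sum_finiteI)
  qed
  then show "\<exists>r>0. \<exists>c. \<forall>x y. \<bar>x - a\<bar> < r \<and> \<bar>y - b\<bar> < r \<longrightarrow>
      ((\<lambda>(i, j). ((x - a) ^ i * (y - b) ^ j) *\<^sub>R c i j) has_sum g y *\<^sub>R F x y) UNIV"
    using r1 r2 by (intro exI[of _ "min r1 r2"] exI[of _ e] conjI allI impI) auto
qed

lemma real_analytic2_on_add:
  assumes F: "real_analytic2_on F S" and G: "real_analytic2_on G S"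
  shows "real_analytic2_on (\<lambda>x y. F x y + G x y) S"
  unfolding real_analytic2_on_def
proof safe
  fix a b assume ab: "(a, b) \<in> S"
  obtain r1 c where r1: "r1 > 0" and
    c: "\<And>x y. \<bar>x - a\<bar> < r1 \<Longrightarrow> \<bar>y - b\<bar> < r1 \<Longrightarrow>
        ((\<lambda>(i, j). ((x - a) ^ i * (y - b) ^ j) *\<^sub>R c i j) has_sum F x y) UNIV"
    using F ab unfolding real_analytic2_on_def by blast
  obtain r2 d where r2: "r2 > 0" and
    d: "\<And>x y. \<bar>x - a\<bar> < r2 \<Longrightarrow> \<bar>y - b\<bar> < r2 \<Longrightarrow>
        ((\<lambda>(i, j). ((x - a) ^ i * (y - b) ^ j) *\<^sub>R d i j) has_sum G x y) UNIV"
    using G ab unfolding real_analytic2_on_def by blast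
  have "((\<lambda>(i, j). ((x - a) ^ i * (y - b) ^ j) *\<^sub>R (c i j + d i j)) has_sum F x y + G x y) UNIV"
    if "\<bar>x - a\<bar> < min r1 r2" "\<bar>y - b\<bar> < min r1 r2" for x y
    using has_sum_add[OF c d, of x y x y] that
    by (simp add: case_prod_unfold scaleR_add_right)
  then show "\<exists>r>0. \<exists>c. \<forall>x y. \<bar>x - a\<bar> < r \<and> \<bar>y - b\<bar> < r \<longrightarrow>
      ((\<lambda>(i, j). ((x - a) ^ i * (y - b) ^ j) *\<^sub>R c i j) has_sum F x y + G x y) UNIV"
    using r1 r2
    by (intro exI[of _ "min r1 r2"] exI[of _ "\<lambda>i j. c i j + d i j"] conjI allI impI) auto
qed

lemma real_analytic_on_const: "real_analytic_on (\<lambda>t. c) S"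
  unfolding real_analytic_on_def
proof
  fix a assume "a \<in> S"
  let ?d = "\<lambda>n::nat. if n = 0 then c else 0"
  have "(\<lambda>n. (t - a) ^ n *\<^sub>R ?d n) sums c" for t
    using sums_single[of 0 "\<lambda>_. c"] by (rule sums_cong[THEN iffD1, rotated]) auto
  then show "\<exists>r>0. \<exists>d. \<forall>t. \<bar>t - a\<bar> < r \<longrightarrow> (\<lambda>n. (t - a) ^ n *\<^sub>R d n) sums c"
    by (intro exI[of _ 1] exI[of _ ?d] conjI allI impI) (simp, blast)
qed

lemma real_analytic2_on_diff:
  fixes F :: "real \<Rightarrow> real \<Rightarrow> 'a::euclidean_space"
  assumes "real_analytic2_on F S" "real_analytic2_on G S"
  shows "real_analytic2_on (\<lambda>x y. F x y - G x y) S"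
  using real_analytic2_on_add[OF assms(1)
      real_analytic2_on_scaleR[OF real_analytic_on_const[of "- 1"] assms(2)]] by simp

lemma real_analytic2_on_const: "real_analytic2_on (\<lambda>x y. c) S"
  unfolding real_analytic2_on_def
proof safe
  fix a b
  let ?d = "\<lambda>i j :: nat. if (i, j) = (0 :: nat, 0) then c else 0"
  have "((\<lambda>(i, j). ((x - a) ^ i * (y - b) ^ j) *\<^sub>R ?d i j) has_sum c) UNIV" for x y
    by (rule has_sum_finite_neutralI[of "{(0, 0)}"]) (auto split: if_splits)
  then show "\<exists>r>0. \<exists>d. \<forall>x y. \<bar>x - a\<bar> < r \<and> \<bar>y - b\<bar> < r \<longrightarrow>
      ((\<lambda>(i, j). ((x - a) ^ i * (y - b) ^ j) *\<^sub>R d i j) has_sum c) UNIV"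
    by (intro exI[of _ 1] exI[of _ ?d] conjI allI impI) (simp, blast)
qed

text \<open>Expanding around \<open>(a, b)\<close> and then setting \<open>x = a\<close> leaves only
  the row of pure powers of \<open>y - b\<close>, so \<open>c 0\<close> serves as the coefficient
  sequence.\<close>

lemma real_analytic_on_slice:
  assumes F: "real_analytic2_on F S" and S: "\<And>y. y \<in> T \<Longrightarrow> (a, y) \<in> S"
  shows "real_analytic_on (F a) T"
  unfolding real_analytic_on_def
proof
  fix b assume "b \<in> T"
  with F S obtain r c where r: "r > 0" and
    c: "\<And>x y. \<bar>x - a\<bar> < r \<Longrightarrow> \<bar>y - b\<bar> < r \<Longrightarrow>
        ((\<lambda>(i, j). ((x - a) ^ i * (y - b) ^ j) *\<^sub>R c i j) has_sum F x y) UNIV"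
    unfolding real_analytic2_on_def by blast
  have "(\<lambda>j. (y - b) ^ j *\<^sub>R c 0 j) sums F a y" if "\<bar>y - b\<bar> < r" for y
  proof (rule has_sum_imp_sums)
    have "((\<lambda>(i, j). ((a - a) ^ i * (y - b) ^ j) *\<^sub>R c i j) has_sum F a y) UNIV"
      using c[of a y] r that by (simp del: diff_self)
    \<comment> \<open>For \<open>i > 0\<close> the factor \<open>(a - a) ^ i\<close> vanishes, while
      \<open>0 ^ 0 = 1\<close> preserves the row \<open>i = 0\<close>.\<close>
    also have "?this \<longleftrightarrow>
        ((\<lambda>(i, j). ((a - a) ^ i * (y - b) ^ j) *\<^sub>R c i j) has_sum F a y) (range (Pair 0))"
      by (rule has_sum_cong_neutral) auto
    also have "\<dots> \<longleftrightarrow> ((\<lambda>j. (y - b) ^ j *\<^sub>R c 0 j) has_sum F a y) UNIV"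
      by (subst has_sum_reindex) (auto simp: o_def inj_on_def)
    finally show "((\<lambda>j. (y - b) ^ j *\<^sub>R c 0 j) has_sum F a y) UNIV" .
  qed
  then show "\<exists>r>0. \<exists>c. \<forall>y. \<bar>y - b\<bar> < r \<longrightarrow> (\<lambda>n. (y - b) ^ n *\<^sub>R c n) sums F a y"
    using r by blast
qed

section \<open>Analyticity of the scalar factors by holomorphic extension\<close>

text \<open>The strip contains the unit disc around every real point, so the Taylor series of
  \<open>g\<close> converges there; at real arguments its real part is a real power series. The
  strip ends at the zeros of \<open>1 + z\<^sup>2\<close>, the points i and -i.\<close>

lemma real_analytic_on_Re_holomorphic:
  assumes g: "g holomorphic_on {z. \<bar>Im z\<bar> < 1}"
    and f: "\<And>t. f t = Re (g (of_real t))"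
  shows "real_analytic_on f UNIV"
  unfolding real_analytic_on_def
proof
  fix a :: real
  have "ball (of_real a) 1 \<subseteq> {z. \<bar>Im z\<bar> < 1}"
  proof safe
    fix z :: complex assume "z \<in> ball (of_real a) 1"
    then show "\<bar>Im z\<bar> < 1"
      using abs_Im_le_cmod[of "of_real a - z"] by (simp add: dist_norm)
  qed
  with g have hol: "g holomorphic_on ball (of_real a) 1"
    by (rule holomorphic_on_subset)
  let ?c = "\<lambda>n. (deriv ^^ n) g (of_real a) / fact n"
  have "(\<lambda>n. (t - a) ^ n *\<^sub>R Re (?c n)) sums f t" if "\<bar>t - a\<bar> < 1" for t
  proof -
    have "of_real t \<in> ball (of_real a :: complex) 1"
      using that by (simp add: dist_of_real dist_real_def abs_minus_commute)
    from holomorphic_power_series[OF hol this]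
    have "(\<lambda>n. Re (?c n * of_real ((t - a) ^ n))) sums Re (g (of_real t))"
      by (intro bounded_linear.sums[OF bounded_linear_Re]) simp
    moreover have "Re (z * of_real s) = s *\<^sub>R Re z" for z s
      by simp
    ultimately show ?thesis
      by (simp only: f)
  qed
  then show "\<exists>r>0. \<exists>c. \<forall>t. \<bar>t - a\<bar> < r \<longrightarrow> (\<lambda>n. (t - a) ^ n *\<^sub>R c n) sums f t"
    by (intro exI[of _ 1] exI[of _ "\<lambda>n. Re (?c n)"] conjI allI impI) (simp, blast)
qed

text \<open>The real part is 1 plus the square of \<open>Re z\<close> minus that of
  \<open>Im z\<close>. Positivity keeps \<open>1 + z\<^sup>2\<close> away from zero and from the
  branch cut of \<open>powr\<close>.\<close>

lemma Re_one_plus_square_pos: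
  assumes "\<bar>Im z\<bar> < 1"
  shows "Re (1 + z\<^sup>2) > 0"
proof -
  have "(Im z)\<^sup>2 < 1"
    using assms by (simp add: abs_square_less_1)
  then show ?thesis
    by (simp add: add_pos_nonneg power2_eq_square algebra_simps) (smt (verit) zero_le_square)
qed

text \<open>Follows from \<open>5 + 4 * z\<^sup>2 = 1 + 4 * (1 + z\<^sup>2)\<close>.\<close>

lemma Re_five_plus_square_pos:
  assumes "\<bar>Im z\<bar> < 1"
  shows "Re (5 + 4 * z\<^sup>2) > 0"
  using Re_one_plus_square_pos[OF assms] by simp

lemma real_analytic_powr_one:
  "real_analytic_on (\<lambda>y. (1 + y\<^sup>2) powr (- 1 / 2)) UNIV"
proof (rule real_analytic_on_Re_holomorphic)
  show "(\<lambda>z. (1 + z\<^sup>2) powr (- 1 / 2)) holomorphic_on {z. \<bar>Im z\<bar> < 1}"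
    using Re_one_plus_square_pos
    by (intro holomorphic_intros) (force simp: complex_nonpos_Reals_iff)
  fix t :: real
  have "complex_of_real ((1 + t\<^sup>2) powr (- 1 / 2)) = (1 + (complex_of_real t)\<^sup>2) powr (- 1 / 2)"
    by (subst powr_of_real[symmetric]) auto
  then show "(1 + t\<^sup>2) powr (- 1 / 2) = Re ((1 + (complex_of_real t)\<^sup>2) powr (- 1 / 2))"
    by (metis Re_complex_of_real)
qed

text \<open>The extension is a product of two principal powers, since the right half-plane bound is
  available for each factor separately.\<close>

lemma real_analytic_powr_product:
  "real_analytic_on (\<lambda>y. ((1 + y\<^sup>2) * (5 + 4 * y\<^sup>2)) powr (- 1 / 2)) UNIV"
proof (rule real_analytic_on_Re_holomorphic)
  show "(\<lambda>z. (1 + z\<^sup>2) powr (- 1 / 2) * (5 + 4 * z\<^sup>2) powr (- 1 / 2)) holomorphic_on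
      {z. \<bar>Im z\<bar> < 1}"
    using Re_one_plus_square_pos Re_five_plus_square_pos
    by (intro holomorphic_intros) (force simp: complex_nonpos_Reals_iff)+
  fix t :: real
  have "complex_of_real (((1 + t\<^sup>2) * (5 + 4 * t\<^sup>2)) powr (- 1 / 2)) =
      (1 + (complex_of_real t)\<^sup>2) powr (- 1 / 2) * (5 + 4 * (complex_of_real t)\<^sup>2) powr (- 1 / 2)"
    by (simp add: powr_mult powr_of_real[symmetric])
  then show "((1 + t\<^sup>2) * (5 + 4 * t\<^sup>2)) powr (- 1 / 2) =
      Re ((1 + (complex_of_real t)\<^sup>2) powr (- 1 / 2) * (5 + 4 * (complex_of_real t)\<^sup>2) powr (- 1 / 2))"
    by (metis Re_complex_of_real)
qed

text \<open>This is the scalar left in \<open>radius_scaleR_direction\<close> once the square roots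
  have cancelled; it enters the analyticity of the centre curve.\<close>

lemma real_analytic_inverse_one:
  "real_analytic_on (\<lambda>y. 1 / (2 * sqrt 5 * (1 + y\<^sup>2))) UNIV"
proof (rule real_analytic_on_Re_holomorphic)
  show "(\<lambda>z. 1 / (of_real (2 * sqrt 5) * (1 + z\<^sup>2))) holomorphic_on {z. \<bar>Im z\<bar> < 1}"
  proof (intro holomorphic_intros)
    fix z :: complex assume "z \<in> {z. \<bar>Im z\<bar> < 1}"
    then have "1 + z\<^sup>2 \<noteq> 0"
      using Re_one_plus_square_pos[of z] by (metis less_irrefl mem_Collect_eq zero_complex.sel(1))
    then show "complex_of_real (2 * sqrt 5) * (1 + z\<^sup>2) \<noteq> 0"
      by simp
  qed
  show "1 / (2 * sqrt 5 * (1 + t\<^sup>2)) =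
      Re (1 / (of_real (2 * sqrt 5) * (1 + (complex_of_real t)\<^sup>2)))" for t
    unfolding of_real_power[symmetric] of_real_1[symmetric, where 'a = complex]
      of_real_add[symmetric] of_real_mult[symmetric] of_real_divide[symmetric] by simp
qed

lemma real_analytic_ident: "real_analytic_on (\<lambda>y. y) UNIV"
  by (rule real_analytic_on_Re_holomorphic[where g = "\<lambda>z. z"]) (auto intro: holomorphic_intros)

lemma real_analytic_twice_one_plus_square: "real_analytic_on (\<lambda>y. 2 * (1 + y\<^sup>2)) UNIV"
  by (rule real_analytic_on_Re_holomorphic[where g = "\<lambda>z. 2 * (1 + z\<^sup>2)"])
     (auto intro!: holomorphic_intros simp: power2_eq_square)

lemmas real_analytic2_intros =
  real_analytic2_on_add real_analytic2_on_diff real_analytic2_on_scaleR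
  real_analytic_powr_one real_analytic_powr_product real_analytic_inverse_one
  real_analytic_ident real_analytic_twice_one_plus_square

section \<open>The sphere containing an x-curve\<close>

lemma powr_minus_half: "a powr (- 1 / 2) = 1 / sqrt a" if "a > 0" for a :: real
  using that by (simp add: powr_minus_divide powr_half_sqrt)

lemma sphere_radius_pos: "sphere_radius y > 0"
  by (simp add: sphere_radius_def add_pos_nonneg)

text \<open>The root of \<open>5 + 4 * y\<^sup>2\<close> cancels and that of
  \<open>1 + y\<^sup>2\<close> occurs twice, so the radius vector has coefficients rational in
  \<open>y\<close>. Differentiation and the analyticity of the centre both use this form.\<close>

lemma radius_scaleR_direction:
  "sphere_radius y *\<^sub>R sphere_direction \<phi> X\<beta> \<xi> x y =
     (1 / (2 * sqrt 5 * (1 + y\<^sup>2))) *\<^sub>R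
       (X\<beta> x y - (2 * (1 + y\<^sup>2)) *\<^sub>R \<xi> x y + y *\<^sub>R \<phi> x y)"
proof -
  have p: "1 + y\<^sup>2 > 0" "5 + 4 * y\<^sup>2 > 0"
    by (auto intro: add_pos_nonneg)
  then have "sphere_radius y * ((1 + y\<^sup>2) * (5 + 4 * y\<^sup>2)) powr (- 1 / 2) =
      1 / (2 * sqrt 5 * (sqrt (1 + y\<^sup>2) * sqrt (1 + y\<^sup>2)))"
    by (subst powr_minus_half) (auto simp: sphere_radius_def real_sqrt_divide real_sqrt_mult)
  also have "sqrt (1 + y\<^sup>2) * sqrt (1 + y\<^sup>2) = 1 + y\<^sup>2"
    using p by simp
  finally show ?thesis
    by (simp add: sphere_direction_def)
qed

text \<open>Naming the constant as the value at 1 makes it an explicit function of \<open>y\<close>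
  when applied to each x-curve.\<close>

lemma vector_derivative_zero_const_pos:
  fixes F :: "real \<Rightarrow> 'a::real_normed_vector"
  assumes "\<And>x. x > 0 \<Longrightarrow> (F has_vector_derivative 0) (at x)" and "x > 0"
  shows "F x = F 1"
proof -
  have "(F has_vector_derivative 0) (at t within {0<..})" if "t \<in> {0<..}" for t
    using assms(1) that by (simp add: has_vector_derivative_at_within)
  then obtain c where c: "\<And>t. t \<in> {0<..} \<Longrightarrow> F t = c"
    using has_vector_derivative_zero_constant[OF convex_real_interval(3)] by metis
  show ?thesis
    using c[of x] c[of 1] \<open>x > 0\<close> by simp
qed

section \<open>Motion of the frame and of the surface along an x-curve\<close>

context
  fixes \<phi> X\<alpha> X\<beta> \<xi> :: "real \<Rightarrow> real \<Rightarrow> real ^ 4"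
  assumes frame: "frame_field \<phi> X\<alpha> X\<beta> \<xi>"
begin

lemma frame_x_derivatives:
  assumes "x > 0"
  shows "((\<lambda>s. \<phi> s y) has_vector_derivative - a1 x y *\<^sub>R X\<alpha> x y) (at x)"
    and "((\<lambda>s. \<xi> s y) has_vector_derivative b1 x y *\<^sub>R X\<alpha> x y) (at x)"
    and "((\<lambda>s. X\<beta> s y) has_vector_derivative c1 x y *\<^sub>R X\<alpha> x y) (at x)"
proof -
  have "(x, y) \<in> domD"
    using assms by (simp add: domD_def)
  then show "((\<lambda>s. \<phi> s y) has_vector_derivative - a1 x y *\<^sub>R X\<alpha> x y) (at x)"
    and "((\<lambda>s. \<xi> s y) has_vector_derivative b1 x y *\<^sub>R X\<alpha> x y) (at x)"
    and "((\<lambda>s. X\<beta> s y) has_vector_derivative c1 x y *\<^sub>R X\<alpha> x y) (at x)"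
    using frame unfolding frame_field_def by blast+
qed

lemma frame_inner:
  assumes "x > 0"
  shows "\<phi> x y \<bullet> \<phi> x y = 1" "X\<beta> x y \<bullet> X\<beta> x y = 1" "\<xi> x y \<bullet> \<xi> x y = 1"
    and "\<phi> x y \<bullet> X\<beta> x y = 0" "X\<beta> x y \<bullet> \<phi> x y = 0" "\<phi> x y \<bullet> \<xi> x y = 0"
    and "\<xi> x y \<bullet> \<phi> x y = 0" "X\<beta> x y \<bullet> \<xi> x y = 0" "\<xi> x y \<bullet> X\<beta> x y = 0"
proof -
  have "orthonormal_frame (\<phi> x y) (X\<alpha> x y) (X\<beta> x y) (\<xi> x y)"
    using frame assms unfolding frame_field_def domD_def by blast
  then show "\<phi> x y \<bullet> \<phi> x y = 1" "X\<beta> x y \<bullet> X\<beta> x y = 1" "\<xi> x y \<bullet> \<xi> x y = 1"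
    "\<phi> x y \<bullet> X\<beta> x y = 0" "X\<beta> x y \<bullet> \<phi> x y = 0" "\<phi> x y \<bullet> \<xi> x y = 0"
    "\<xi> x y \<bullet> \<phi> x y = 0" "X\<beta> x y \<bullet> \<xi> x y = 0" "\<xi> x y \<bullet> X\<beta> x y = 0"
    by (simp_all add: orthonormal_frame_def norm_eq_1 inner_commute[of "X\<beta> x y" "\<phi> x y"]
        inner_commute[of "\<xi> x y" "\<phi> x y"] inner_commute[of "\<xi> x y" "X\<beta> x y"])
qed

text \<open>The derivative is the multiple \<open>y * c1 x y + a1 x y\<close> of
  \<open>X\<alpha>\<close>, and this scalar is zero because \<open>a1\<close> is \<open>- y\<close>
  times \<open>c1\<close>.\<close>

lemma normal_vector_const:
  assumes "x > 0"
  shows "y *\<^sub>R X\<beta> x y - \<phi> x y = y *\<^sub>R X\<beta> 1 y - \<phi> 1 y"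
proof (rule vector_derivative_zero_const_pos[OF _ assms])
  fix x :: real assume "x > 0"
  note d = frame_x_derivatives[OF this, of y]
  have "y * c1 x y + a1 x y = 0"
    by (simp add: a1_def c1_def)
  then have "y *\<^sub>R c1 x y *\<^sub>R X\<alpha> x y - (- a1 x y *\<^sub>R X\<alpha> x y) = 0"
    by (metis diff_minus_eq_add scaleR_left_distrib scaleR_minus_left scaleR_scaleR scaleR_zero_left)
  moreover have "((\<lambda>x. y *\<^sub>R X\<beta> x y - \<phi> x y) has_vector_derivative
      y *\<^sub>R c1 x y *\<^sub>R X\<alpha> x y - (- a1 x y *\<^sub>R X\<alpha> x y)) (at x)"
    by (rule has_vector_derivative_diff
        [OF bounded_linear.has_vector_derivative[OF bounded_linear_scaleR_right d(3)] d(1)])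
  ultimately show "((\<lambda>x. y *\<^sub>R X\<beta> x y - \<phi> x y) has_vector_derivative 0) (at x)"
    by metis
qed

lemma norm_normal_vector:
  assumes "x > 0"
  shows "norm (y *\<^sub>R X\<beta> x y - \<phi> x y) = sqrt (1 + y\<^sup>2)"
  unfolding norm_eq_sqrt_inner
  by (simp add: inner_diff_left inner_diff_right frame_inner[OF assms] power2_eq_square)

text \<open>By orthonormality the squared length before scaling is
  \<open>1 + 4 * (1 + y\<^sup>2)\<^sup>2 + y\<^sup>2\<close>, which factors as
  \<open>(1 + y\<^sup>2) * (5 + 4 * y\<^sup>2)\<close>.\<close>

lemma norm_sphere_direction:
  assumes "x > 0"
  shows "norm (sphere_direction \<phi> X\<beta> \<xi> x y) = 1"
proof -
  have pos: "(1 + y\<^sup>2) * (5 + 4 * y\<^sup>2) > 0"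
    by (auto intro!: mult_pos_pos add_pos_nonneg)
  have "norm (X\<beta> x y - (2 * (1 + y\<^sup>2)) *\<^sub>R \<xi> x y + y *\<^sub>R \<phi> x y) =
      sqrt ((1 + y\<^sup>2) * (5 + 4 * y\<^sup>2))"
    unfolding norm_eq_sqrt_inner
    by (simp add: inner_diff_left inner_diff_right inner_add_left inner_add_right
        frame_inner[OF assms] power2_eq_square) (simp add: algebra_simps)
  with pos show ?thesis
    unfolding sphere_direction_def by (subst powr_minus_half) auto
qed

text \<open>The \<open>X\<beta>\<close> components contribute \<open>y\<close>, the
  \<open>\<phi>\<close> components \<open>- y\<close>, and \<open>\<xi>\<close> is orthogonal to
  both. This places the x-curve in a hyperplane.\<close>

lemma normal_inner_sphere_direction:
  assumes "x > 0"
  shows "(y *\<^sub>R X\<beta> x y - \<phi> x y) \<bullet> sphere_direction \<phi> X\<beta> \<xi> x y = 0"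
  by (simp add: sphere_direction_def inner_diff_left inner_diff_right inner_add_right
      frame_inner[OF assms])

lemma real_analytic2_sphere_direction:
  "real_analytic2_on (sphere_direction \<phi> X\<beta> \<xi>) domD"
  unfolding sphere_direction_def[abs_def]
  using frame unfolding frame_field_def by (intro real_analytic2_intros) auto

text \<open>Both \<open>f\<close> and the radius vector have x-derivatives along
  \<open>X\<alpha>\<close>, with the same scalar factor
  \<open>(x\<^sup>2 - y\<^sup>2) / (x * h x y)\<close>.\<close>

lemma curvature_surface_center_const:
  assumes surface: "curvature_surface X\<alpha> X\<beta> f" and "x > 0"
  shows "f x y - sphere_radius y *\<^sub>R sphere_direction \<phi> X\<beta> \<xi> x y =
    f 1 y - sphere_radius y *\<^sub>R sphere_direction \<phi> X\<beta> \<xi> 1 y"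
proof (rule vector_derivative_zero_const_pos[OF _ \<open>x > 0\<close>])
  fix x :: real assume x: "x > 0"
  note d = frame_x_derivatives[OF x, of y]
  define k where "k = 1 / (2 * sqrt 5 * (1 + y\<^sup>2))"
  define w where "w = X\<alpha> x y"
  have df: "((\<lambda>(s, t). f s t) has_derivative
          (\<lambda>(dx, dy). dx *\<^sub>R (((x\<^sup>2 - y\<^sup>2) / (x * h x y)) *\<^sub>R X\<alpha> x y)
                    + dy *\<^sub>R ((2 * y / h x y) *\<^sub>R X\<beta> x y))) (at (x, y))"
    using surface x unfolding curvature_surface_def domD_def by auto
  \<comment> \<open>Composition with the horizontal line through \<open>(x, y)\<close> extracts the
    x-derivative from the total derivative of \<open>f\<close>.\<close>
  have "((\<lambda>s. (s, y)) has_derivative (\<lambda>s. (s, 0))) (at x)"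
    by (auto intro!: derivative_eq_intros)
  from has_derivative_compose[OF this df] have f: "((\<lambda>s. f s y) has_vector_derivative ((x\<^sup>2 - y\<^sup>2) / (x * h x y)) *\<^sub>R w) (at x)"
    by (simp add: has_vector_derivative_def w_def)
  have v: "((\<lambda>s. k *\<^sub>R (X\<beta> s y - (2 * (1 + y\<^sup>2)) *\<^sub>R \<xi> s y + y *\<^sub>R \<phi> s y)) has_vector_derivative
      k *\<^sub>R (c1 x y *\<^sub>R w - (2 * (1 + y\<^sup>2)) *\<^sub>R b1 x y *\<^sub>R w + y *\<^sub>R (- a1 x y *\<^sub>R w))) (at x)"
    using d unfolding w_def
    by (intro bounded_linear.has_vector_derivative[OF bounded_linear_scaleR_right]
        has_vector_derivative_add has_vector_derivative_diff)
  have nz: "1 + y\<^sup>2 \<noteq> 0"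
    by (smt (verit) zero_le_power2)
  \<comment> \<open>The multiples of \<open>X0 x + sqrt 5 / 2\<close> have total factor
    \<open>- 2 + 2 * (1 + y\<^sup>2) - 2 * y\<^sup>2 = 0\<close>; only the
    \<open>x\<^sup>2 - y\<^sup>2\<close> term of \<open>b1\<close> survives.\<close>
  have "c1 x y - 2 * (1 + y\<^sup>2) * b1 x y - y * a1 x y =
      2 * sqrt 5 * (1 + y\<^sup>2) * ((x\<^sup>2 - y\<^sup>2) / (x * h x y))"
    unfolding a1_def b1_def c1_def divide_inverse by algebra
  then have "k * (c1 x y - 2 * (1 + y\<^sup>2) * b1 x y - y * a1 x y) = (x\<^sup>2 - y\<^sup>2) / (x * h x y)"
    using nz by (simp add: k_def)
  moreover have "k *\<^sub>R (c1 x y *\<^sub>R w - (2 * (1 + y\<^sup>2)) *\<^sub>R b1 x y *\<^sub>R w + y *\<^sub>R (- a1 x y *\<^sub>R w)) =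
      (k * (c1 x y - 2 * (1 + y\<^sup>2) * b1 x y - y * a1 x y)) *\<^sub>R w"
    by (simp add: scaleR_left_distrib scaleR_right_distrib scaleR_left_diff_distrib
        scaleR_right_diff_distrib right_diff_distrib)
  ultimately have "k *\<^sub>R (c1 x y *\<^sub>R w - (2 * (1 + y\<^sup>2)) *\<^sub>R b1 x y *\<^sub>R w
        + y *\<^sub>R (- a1 x y *\<^sub>R w)) = ((x\<^sup>2 - y\<^sup>2) / (x * h x y)) *\<^sub>R w"
    by (simp only:)
  from has_vector_derivative_diff[OF f v, unfolded this]
  show "((\<lambda>x. f x y - sphere_radius y *\<^sub>R sphere_direction \<phi> X\<beta> \<xi> x y)
      has_vector_derivative 0) (at x)"
    unfolding radius_scaleR_direction k_def diff_self .
qed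

end

section \<open>Surfaces with the same frame\<close>

lemma curvature_surface_add_const:
  assumes "curvature_surface X\<alpha> X\<beta> f"
  shows "curvature_surface X\<alpha> X\<beta> (\<lambda>x y. f x y + c)"
  using assms unfolding curvature_surface_def
  by (auto simp: case_prod_unfold intro!: real_analytic2_on_add real_analytic2_on_const
      has_derivative_add_const)

text \<open>The frame prescribes the total derivative, so the difference of two surfaces has
  derivative zero on the convex set \<open>domD\<close>.\<close>

lemma curvature_surface_unique:
  assumes f: "curvature_surface X\<alpha> X\<beta> f" and g: "curvature_surface X\<alpha> X\<beta> g"
  obtains c where "\<And>x y. x > 0 \<Longrightarrow> g x y = f x y + c"
proof -
  have "\<exists>c. \<forall>p\<in>domD. (\<lambda>(s, t). g s t) p - (\<lambda>(s, t). f s t) p = c"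
  proof (rule has_derivative_zero_constant)
    have dom: "domD = {0<..} \<times> UNIV"
      by (auto simp: domD_def)
    show "convex domD"
      unfolding dom by (intro convex_Times convex_real_interval convex_UNIV)
    fix p assume "p \<in> domD"
    then obtain D where "((\<lambda>(s, t). g s t) has_derivative D) (at p)"
      "((\<lambda>(s, t). f s t) has_derivative D) (at p)"
      using f g unfolding curvature_surface_def by (cases p) blast
    from has_derivative_diff[OF this]
    show "((\<lambda>p. (\<lambda>(s, t). g s t) p - (\<lambda>(s, t). f s t) p) has_derivative (\<lambda>h. 0)) (at p within domD)"
      by (auto intro: has_derivative_at_withinI)
  qed
  then obtain c where c: "\<forall>p\<in>domD. (\<lambda>(s, t). g s t) p - (\<lambda>(s, t). f s t) p = c"
    by blast
  have "g x y = f x y + c" if "x > 0" for x y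
    using bspec[OF c, of "(x, y)"] that by (simp add: domD_def algebra_simps)
  then show ?thesis
    by (rule that)
qed

text \<open>The frame fixes \<open>f0\<close> only up to translation, so uniqueness of
  \<open>A\<close> ranges over all surfaces of that frame: their centre curves are exactly the
  translates of \<open>A\<close>.\<close>

theorem theorem3p5:
  fixes \<phi> X\<alpha> X\<beta> \<xi> f0 :: "real \<Rightarrow> real \<Rightarrow> real ^ 4"
  assumes frame: "frame_field \<phi> X\<alpha> X\<beta> \<xi>"
    and surface: "curvature_surface X\<alpha> X\<beta> f0"
  shows
    "(\<forall>y. \<exists>v. \<forall>x>0. y *\<^sub>R X\<beta> x y - \<phi> x y = v) \<and>
     real_analytic2_on (sphere_direction \<phi> X\<beta> \<xi>) domD \<and>
     (\<forall>x>0. \<forall>y. norm (sphere_direction \<phi> X\<beta> \<xi> x y) = 1) \<and>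
     (\<exists>u A :: real \<Rightarrow> real ^ 4.
        real_analytic_on u UNIV \<and>
        (\<forall>y. norm (u y) = 1) \<and>
        (\<forall>x>0. \<forall>y. u y = (1 + y\<^sup>2) powr (- 1 / 2) *\<^sub>R (y *\<^sub>R X\<beta> x y - \<phi> x y)) \<and>
        real_analytic_on A UNIV \<and>
        (\<forall>x>0. \<forall>y. f0 x y = sphere_radius y *\<^sub>R sphere_direction \<phi> X\<beta> \<xi> x y + A y) \<and>
        (\<forall>B :: real \<Rightarrow> real ^ 4.
           (\<exists>g. curvature_surface X\<alpha> X\<beta> g \<and>
                (\<forall>x>0. \<forall>y. g x y = sphere_radius y *\<^sub>R sphere_direction \<phi> X\<beta> \<xi> x y + B y))
           \<longleftrightarrow> (\<exists>c. \<forall>y. B y = A y + c)) \<and>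
        (\<forall>y. sphere_radius y > 0 \<and>
           (\<exists>d. A y \<in> {p. u y \<bullet> p = d} \<and>
                (\<forall>x>0. f0 x y \<in> sphere (A y) (sphere_radius y) \<inter> {p. u y \<bullet> p = d}))))"
proof -
  define u where "u y = (1 + y\<^sup>2) powr (- 1 / 2) *\<^sub>R (y *\<^sub>R X\<beta> 1 y - \<phi> 1 y)" for y
  define A where "A y = f0 1 y - sphere_radius y *\<^sub>R sphere_direction \<phi> X\<beta> \<xi> 1 y" for y
  have an: "real_analytic2_on \<phi> domD" "real_analytic2_on X\<beta> domD" "real_analytic2_on \<xi> domD"
    "real_analytic2_on f0 domD"
    using frame surface unfolding frame_field_def curvature_surface_def by auto
  have slice: "(1, y) \<in> domD" for y
    by (simp add: domD_def)
  have u_analytic: "real_analytic_on u UNIV"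
    unfolding u_def
    by (rule real_analytic_on_slice
        [where F = "\<lambda>x y. (1 + y\<^sup>2) powr (- 1 / 2) *\<^sub>R (y *\<^sub>R X\<beta> x y - \<phi> x y)", OF _ slice])
       (intro real_analytic2_intros an)
  have A_analytic: "real_analytic_on A UNIV"
    \<comment> \<open>Passing to the root-free form leaves only analytic scalars from the list
      \<open>real_analytic2_intros\<close>.\<close>
    unfolding A_def radius_scaleR_direction
    by (rule real_analytic_on_slice[where F = "\<lambda>x y. f0 x y - (1 / (2 * sqrt 5 * (1 + y\<^sup>2))) *\<^sub>R
          (X\<beta> x y - (2 * (1 + y\<^sup>2)) *\<^sub>R \<xi> x y + y *\<^sub>R \<phi> x y)", OF _ slice])
       (intro real_analytic2_intros an)
  have u_eq: "u y = (1 + y\<^sup>2) powr (- 1 / 2) *\<^sub>R (y *\<^sub>R X\<beta> x y - \<phi> x y)" if "x > 0" for x y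
    using normal_vector_const[OF frame that] by (simp add: u_def)
  have u_norm: "norm (u y) = 1" for y
  proof -
    have "1 + y\<^sup>2 > 0"
      by (simp add: add_pos_nonneg)
    then show ?thesis
      using norm_normal_vector[OF frame, of 1 y] powr_minus_half[of "1 + y\<^sup>2"]
      by (simp add: u_def)
  qed
  have f0_eq: "f0 x y = sphere_radius y *\<^sub>R sphere_direction \<phi> X\<beta> \<xi> x y + A y" if "x > 0" for x y
    using curvature_surface_center_const[OF frame surface that, of y]
    by (simp add: A_def algebra_simps)
  have unique: "(\<exists>g. curvature_surface X\<alpha> X\<beta> g \<and>
        (\<forall>x>0. \<forall>y. g x y = sphere_radius y *\<^sub>R sphere_direction \<phi> X\<beta> \<xi> x y + B y))
      \<longleftrightarrow> (\<exists>c. \<forall>y. B y = A y + c)" for B :: "real \<Rightarrow> real ^ 4"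
  proof
    assume "\<exists>g. curvature_surface X\<alpha> X\<beta> g \<and>
        (\<forall>x>0. \<forall>y. g x y = sphere_radius y *\<^sub>R sphere_direction \<phi> X\<beta> \<xi> x y + B y)"
    then obtain g where g: "curvature_surface X\<alpha> X\<beta> g"
      "\<And>x y. x > 0 \<Longrightarrow> g x y = sphere_radius y *\<^sub>R sphere_direction \<phi> X\<beta> \<xi> x y + B y"
      by blast
    obtain c where "\<And>x y. x > 0 \<Longrightarrow> g x y = f0 x y + c"
      using curvature_surface_unique[OF surface g(1)] by blast
    \<comment> \<open>Both surfaces carry the same radius vector, so subtracting at
      \<open>x = 1\<close> compares the centres alone.\<close>
    from this[of 1] have "B y = A y + c" for y
      using f0_eq[of 1 y] g(2)[of 1 y] by simp
    then show "\<exists>c. \<forall>y. B y = A y + c"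
      by blast
  next
    assume "\<exists>c. \<forall>y. B y = A y + c"
    then obtain c where "\<And>y. B y = A y + c"
      by blast
    then show "\<exists>g. curvature_surface X\<alpha> X\<beta> g \<and>
        (\<forall>x>0. \<forall>y. g x y = sphere_radius y *\<^sub>R sphere_direction \<phi> X\<beta> \<xi> x y + B y)"
      using curvature_surface_add_const[OF surface, of c] f0_eq
      by (intro exI[of _ "\<lambda>x y. f0 x y + c"]) auto
  qed
  \<comment> \<open>The offset \<open>u y \<bullet> A y\<close> makes the hyperplane pass through
    the centre, so the section is a 2-sphere with the full radius and centre
    \<open>A y\<close>.\<close>
  have sphere: "f0 x y \<in> sphere (A y) (sphere_radius y) \<inter> {p. u y \<bullet> p = u y \<bullet> A y}"
    if "x > 0" for x y
  proof -
    have "u y \<bullet> sphere_direction \<phi> X\<beta> \<xi> x y = 0"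
      using normal_inner_sphere_direction[OF frame that] by (simp add: u_eq[OF that])
    then show ?thesis
      using norm_sphere_direction[OF frame that, of y] sphere_radius_pos[of y]
      by (simp add: f0_eq[OF that] dist_norm inner_add_right)
  qed
  have const: "\<forall>y. \<exists>v. \<forall>x>0. y *\<^sub>R X\<beta> x y - \<phi> x y = v"
    using normal_vector_const[OF frame] by blast
  have plane: "\<exists>d. A y \<in> {p. u y \<bullet> p = d} \<and>
      (\<forall>x>0. f0 x y \<in> sphere (A y) (sphere_radius y) \<inter> {p. u y \<bullet> p = d})" for y
    using sphere by blast
  show ?thesis
    by (intro const real_analytic2_sphere_direction[OF frame] norm_sphere_direction[OF frame]
        exI[where x = u, OF exI[where x = A]] conjI allI impI u_analytic u_norm u_eq A_analytic
        f0_eq unique sphere_radius_pos plane)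
qed

end
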